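(* Let $n\ge1$, $m\ge2$, let $A=(a_{i_1\cdots i_m})\in\overline{\mathbb{R}}^{n^m}$ with $\overline{\mathbb{R}}=\mathbb{R}\cup\{\infty\}$, and assume that the sets $S_i:=\{\{i_2,\ldots,i_m\} : a_{i\,i_2\cdots i_m}\neq\infty\}$, $i\in[n]$, are nonempty and mutually equal. Then the optimal value of the linear program \[ \text{maximize } \lambda \quad\text{over } (\lambda,x)\in\mathbb{R}\times\mathbb{R}^n \quad\text{subject to}\quad a_{i_1 i_2\cdots i_m}+x_{i_2}+\cdots+x_{i_m}\ge \lambda+(m-1)x_{i_1}\ \ \forall (i_1,\ldots,i_m)\in[n]^m \] is equal to the tropical H-eigenvalue $\lambda(A)$ of $A$. Dually, $\lambda(A)$ equals the optimal value of \[ \begin{array}{ll} \text{minimize} & \sum_{(i_1,\ldots,i_m)\in[n]^m} a_{i_1\cdots i_m}\,y_{i_1\cdots i_m}\\ \text{subject to} & \sum_{(i_1,\ldots,i_m)\in[n]^m} y_{i_1\cdots i_m}\bigl((m-1)e_{i_1}-e_{i_2}-\cdots-e_{i_m}\bigr)=0,\\ & \sum_{(i_1,\ldots,i_m)\in[n]^m} y_{i_1\cdots i_m}=1,\qquad y_{i_1\cdots i_m}\ge 0 . \end{array} \]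
   Context: Here $e_1,\ldots,e_n$ are the standard basis vectors of $\mathbb{R}^n$. Arithmetic with $\infty$: $\infty+t=\infty$ and $\infty\ge t$ for all real $t$. A tropical H-eigenpair of $A$ is a pair $(x,\lambda)\in\mathbb{R}^n/\mathbb{R}(1,\ldots,1)\times\mathbb{R}$ with $\min_{i_2,\ldots,i_m\in[n]}(a_{i\,i_2\cdots i_m}+x_{i_2}+\cdots+x_{i_m})=\lambda+(m-1)x_i$ for all $i\in[n]$; under the stated hypotheses there is exactly one such $\lambda$, denoted $\lambda(A)$ and called the tropical H-eigenvalue. Tensors are assumed symmetric in their last $m-1$ indices. *)

theory Defs
  imports "HOL-Analysis.Analysis" "HOL-Library.Multiset"
begin

text \<open>
  The index set $[n]$ is a finite type, and a multi-index $(i_1,\dots,i_m) \in [n]^m$ is a list of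
  length \<open>m\<close>.  A tensor is thus a function on lists, of which only the values on lists of length
  \<open>m\<close> matter; the entries lie in \<open>ereal\<close>, with \<open>-\<infinity>\<close> excluded by \<open>is_tensor\<close>.
\<close>

definition multi_indices :: "nat \<Rightarrow> 'n::finite list set" where
  "multi_indices m = {I. length I = m}"

definition is_tensor :: "nat \<Rightarrow> ('n::finite list \<Rightarrow> ereal) \<Rightarrow> bool" where
  "is_tensor m A \<longleftrightarrow> (\<forall>I \<in> multi_indices m. A I \<noteq> -\<infinity>)"

definition symmetric_in_last :: "nat \<Rightarrow> ('n::finite list \<Rightarrow> ereal) \<Rightarrow> bool" where
  "symmetric_in_last m A \<longleftrightarrow>
     (\<forall>i. \<forall>J \<in> multi_indices (m - 1). \<forall>K \<in> multi_indices (m - 1).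
        mset J = mset K \<longrightarrow> A (i # J) = A (i # K))"

text \<open>
  The members of \<open>support_sets m A i\<close> are plain sets, without multiplicities.  Requiring these
  families to agree for all \<open>i\<close> is weaker than requiring the corresponding families of multisets
  to agree.
\<close>

definition support_sets :: "nat \<Rightarrow> ('n::finite list \<Rightarrow> ereal) \<Rightarrow> 'n \<Rightarrow> 'n set set" where
  "support_sets m A i = {set J | J. J \<in> multi_indices (m - 1) \<and> A (i # J) \<noteq> \<infinity>}"

definition sum_at :: "real ^ 'n::finite \<Rightarrow> 'n list \<Rightarrow> real" where
  "sum_at x J = (\<Sum>j\<leftarrow>J. x $ j)"

text \<open>
  Eigenvectors are given by representatives in $\mathbb{R}^n$: the equations are invariant under
  adding a multiple of $(1,\dots,1)$ to \<open>x\<close>.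
\<close>

definition tropical_H_eigenpair ::
    "nat \<Rightarrow> ('n::finite list \<Rightarrow> ereal) \<Rightarrow> real ^ 'n \<Rightarrow> real \<Rightarrow> bool" where
  "tropical_H_eigenpair m A x l \<longleftrightarrow>
     (\<forall>i. (MIN J \<in> multi_indices (m - 1). A (i # J) + ereal (sum_at x J))
          = ereal (l + (real m - 1) * x $ i))"

definition tropical_H_eigenvalue :: "nat \<Rightarrow> ('n::finite list \<Rightarrow> ereal) \<Rightarrow> real" where
  "tropical_H_eigenvalue m A = (THE l. \<exists>x. tropical_H_eigenpair m A x l)"

definition primal_feasible ::
    "nat \<Rightarrow> ('n::finite list \<Rightarrow> ereal) \<Rightarrow> real \<times> (real ^ 'n) \<Rightarrow> bool" where
  "primal_feasible m A = (\<lambda>(l, x).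
     \<forall>I \<in> multi_indices m.
       A I + ereal (sum_at x (tl I)) \<ge> ereal (l + (real m - 1) * x $ hd I))"

definition primal_optimal_value :: "nat \<Rightarrow> ('n::finite list \<Rightarrow> ereal) \<Rightarrow> real \<Rightarrow> bool" where
  "primal_optimal_value m A v \<longleftrightarrow>
     (\<exists>p. is_arg_max fst (primal_feasible m A) p \<and> fst p = v)"

definition dual_feasible :: "nat \<Rightarrow> ('n::finite list \<Rightarrow> real) \<Rightarrow> bool" where
  "dual_feasible m y \<longleftrightarrow>
     (\<Sum>I \<in> multi_indices m.
        y I *\<^sub>R ((real m - 1) *\<^sub>R axis (hd I) 1 - (\<Sum>j\<leftarrow>tl I. axis j 1))) = (0 :: real ^ 'n) \<and>
     (\<Sum>I \<in> multi_indices m. y I) = 1 \<and>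
     (\<forall>I \<in> multi_indices m. y I \<ge> 0)"

text \<open>
  In \<open>ereal\<close>, \<open>\<infinity> * 0 = 0\<close>, so an infinite entry contributes nothing exactly when its dual variable
  vanishes, and makes the objective infinite otherwise.
\<close>

definition dual_objective ::
    "nat \<Rightarrow> ('n::finite list \<Rightarrow> ereal) \<Rightarrow> ('n list \<Rightarrow> real) \<Rightarrow> ereal" where
  "dual_objective m A y = (\<Sum>I \<in> multi_indices m. A I * ereal (y I))"

definition dual_optimal_value :: "nat \<Rightarrow> ('n::finite list \<Rightarrow> ereal) \<Rightarrow> ereal \<Rightarrow> bool" where
  "dual_optimal_value m A v \<longleftrightarrow>
     (\<exists>y. is_arg_min (dual_objective m A) (dual_feasible m) y \<and> dual_objective m A y = v)"

end

theory Submission imports Defs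
begin

text \<open>
  Write \<open>F\<close> for the Shapley operator whose \<open>i\<close>-th coordinate is the minimum of
  $a_{iJ} + x_J$ over the multi-indices \<open>J\<close> with finite entry.  If \<open>J\<close> and \<open>K\<close> have the same
  underlying set then $x_J$ and $x_K$ share a summand, so, as the sets $S_i$ agree, \<open>F\<close> maps
  vectors of oscillation at most \<open>R\<close> to vectors of oscillation at most $C + (m-2)R$.  For large
  \<open>R\<close> the normalised map $F/(m-1)$ therefore preserves a compact convex set, and Brouwer's theorem
  gives an eigenpair $(x, \lambda)$.  Comparing a primal feasible point with \<open>x\<close> at a coordinate
  where the difference is maximal shows that $\lambda$ is the primal optimum, hence unique.
  Weak duality is the pairing of the dual constraint with \<open>x\<close>.  It is attained by choosing for
  each \<open>i\<close> a minimiser $J_i$ at \<open>x\<close> and giving $(i, J_i)$ the weight of \<open>i\<close> in a stationary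
  distribution of the Markov chain that moves from \<open>i\<close> to a uniformly chosen entry of $J_i$.
\<close>

subsection \<open>Multi-indices\<close>

lemma finite_multi_indices [simp]: "finite (multi_indices m :: 'n::finite list set)"
  using finite_lists_length_eq[of "UNIV :: 'n set" m] by (simp add: multi_indices_def)

lemma Cons_in_multi_indices:
  assumes "m \<ge> 1"
  shows "i # J \<in> multi_indices m \<longleftrightarrow> J \<in> multi_indices (m - 1)"
  using assms by (auto simp: multi_indices_def)

lemma multi_indices_Cons_cases:
  assumes "I \<in> multi_indices m" "m \<ge> 1"
  obtains i J where "I = i # J" "J \<in> multi_indices (m - 1)"
  using assms by (cases I) (auto simp: multi_indices_def)

lemma sum_at_Nil [simp]: "sum_at x [] = 0"
  and sum_at_Cons [simp]: "sum_at x (j # J) = x $ j + sum_at x J"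
  by (simp_all add: sum_at_def)

lemma continuous_on_sum_at [continuous_intros]: "continuous_on S (\<lambda>x. sum_at x J)"
  by (induction J) (auto intro!: continuous_intros)

lemma sum_at_diff_le:
  assumes "length J = length K" "\<And>i j. x $ i - y $ j \<le> R"
  shows "sum_at x J - sum_at y K \<le> real (length J) * R"
  using assms(1)
proof (induction J K rule: list_induct2)
  case (Cons a J b K)
  then show ?case using assms(2)[of a b] by (simp add: algebra_simps)
qed simp

lemma sum_at_remove1:
  assumes "u \<in> set K"
  shows "sum_at x K = x $ u + sum_at x (remove1 u K)"
  using assms by (induction K) auto

text \<open>The head of \<open>J\<close> also occurs in \<open>K\<close>, so it cancels and only
  \<open>length J - 1\<close> pairs of entries remain to be compared. The saved summand is what
  later lets the bound on oscillations close up.\<close>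

lemma sum_at_diff_le_same_set:
  assumes "length J = length K" "set J = set K" "J \<noteq> []" "\<And>i j. x $ i - x $ j \<le> R"
  shows "sum_at x J - sum_at x K \<le> (real (length J) - 1) * R"
proof -
  obtain u J' where J: "J = u # J'" using assms(3) by (cases J) auto
  then have u: "u \<in> set K" using assms(2) by auto
  have "length J' = length (remove1 u K)" using u assms(1) J by (simp add: length_remove1)
  from sum_at_diff_le[OF this assms(4)] show ?thesis
    using sum_at_remove1[OF u, of x] J by simp
qed

lemma sum_at_le_add_const:
  assumes "\<And>i. y $ i \<le> x $ i + c"
  shows "sum_at y J \<le> sum_at x J + real (length J) * c"
proof (induction J)
  case (Cons j J)
  then show ?case using assms[of j] by (simp add: algebra_simps)
qed simp

lemma inner_sum_list_axis: "x \<bullet> (\<Sum>j\<leftarrow>J. axis j 1) = sum_at x J"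
  by (induction J) (auto simp: inner_add_right inner_axis)

lemma sum_list_axis_nth: "(\<Sum>l\<leftarrow>J. axis l (1::real)) $ j = real (count_list J j)"
  by (induction J) (auto simp: axis_def)

lemma sum_count_list:
  "(\<Sum>j\<in>(UNIV :: 'n::finite set). real (count_list J j)) = real (length J)"
proof -
  have "(\<Sum>j\<in>(UNIV :: 'n set). count_list J j) = length J"
    by (rule sum_count_set) auto
  then show ?thesis by (metis of_nat_sum)
qed

subsection \<open>The Shapley operator\<close>

definition finite_tails :: "nat \<Rightarrow> ('n::finite list \<Rightarrow> ereal) \<Rightarrow> 'n \<Rightarrow> 'n list set" where
  "finite_tails m A i = {J \<in> multi_indices (m - 1). A (i # J) \<noteq> \<infinity>}"

text \<open>Restricting the minimum to finite entries keeps the operator real-valued, so that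
  continuity and Brouwer's theorem apply on \<open>real ^ 'n\<close>.\<close>

definition shapley ::
    "nat \<Rightarrow> ('n::finite list \<Rightarrow> ereal) \<Rightarrow> real ^ 'n \<Rightarrow> 'n \<Rightarrow> real" where
  "shapley m A x i = (MIN J \<in> finite_tails m A i. real_of_ereal (A (i # J)) + sum_at x J)"

lemma finite_finite_tails [simp]: "finite (finite_tails m A i)"
  by (simp add: finite_tails_def)

lemma support_sets_eq_image: "support_sets m A i = set ` finite_tails m A i"
  by (auto simp: support_sets_def finite_tails_def)

lemma shapley_le:
  assumes "J \<in> finite_tails m A i"
  shows "shapley m A x i \<le> real_of_ereal (A (i # J)) + sum_at x J"
  using assms by (auto simp: shapley_def intro!: Min_le)

lemma shapley_attained:
  assumes "finite_tails m A i \<noteq> {}"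
  obtains J where "J \<in> finite_tails m A i"
    "shapley m A x i = real_of_ereal (A (i # J)) + sum_at x J"
proof -
  have "shapley m A x i \<in> (\<lambda>J. real_of_ereal (A (i # J)) + sum_at x J) ` finite_tails m A i"
    unfolding shapley_def using assms by (intro Min_in) auto
  then show ?thesis using that by auto
qed

lemma continuous_on_Min_finite:
  fixes f :: "'i \<Rightarrow> 'a::topological_space \<Rightarrow> real"
  assumes "finite T" "T \<noteq> {}" "\<And>t. t \<in> T \<Longrightarrow> continuous_on S (f t)"
  shows "continuous_on S (\<lambda>x. MIN t \<in> T. f t x)"
  using assms by (induction T rule: finite_ne_induct) (auto intro!: continuous_on_min)

lemma continuous_on_shapley:
  assumes "finite_tails m A i \<noteq> {}"
  shows "continuous_on S (\<lambda>x. shapley m A x i)"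
  unfolding shapley_def using assms
  by (intro continuous_on_Min_finite) (auto intro!: continuous_intros)

lemma tensor_entry_real:
  assumes "m \<ge> 1" "is_tensor m A" "J \<in> finite_tails m A i"
  shows "A (i # J) = ereal (real_of_ereal (A (i # J)))"
  using assms Cons_in_multi_indices[of m i J]
  by (cases "A (i # J)") (auto simp: is_tensor_def finite_tails_def)

text \<open>An infinite entry never undercuts a finite one, and a finite one exists, so nothing is
  lost in passing from \<open>ereal\<close> to real numbers.\<close>

lemma Min_tensor_eq_shapley:
  assumes "m \<ge> 1" "is_tensor m A" "finite_tails m A i \<noteq> {}"
  shows "(MIN J \<in> multi_indices (m - 1). A (i # J) + ereal (sum_at x J))
           = ereal (shapley m A x i)"
proof (rule Min_eqI)
  show "ereal (shapley m A x i)
          \<in> (\<lambda>J. A (i # J) + ereal (sum_at x J)) ` multi_indices (m - 1)"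
  proof (rule shapley_attained[OF assms(3), of x])
    fix J
    assume J: "J \<in> finite_tails m A i"
      and eq: "shapley m A x i = real_of_ereal (A (i # J)) + sum_at x J"
    have "ereal (shapley m A x i) = A (i # J) + ereal (sum_at x J)"
      unfolding eq by (subst (2) tensor_entry_real[OF assms(1,2) J]) simp
    then show ?thesis using J by (auto simp: finite_tails_def)
  qed
next
  fix v
  assume "v \<in> (\<lambda>J. A (i # J) + ereal (sum_at x J)) ` multi_indices (m - 1)"
  then obtain J where J: "J \<in> multi_indices (m - 1)" "v = A (i # J) + ereal (sum_at x J)"
    by auto
  show "ereal (shapley m A x i) \<le> v"
  proof (cases "A (i # J) = \<infinity>")
    case False
    then have T: "J \<in> finite_tails m A i" using J by (simp add: finite_tails_def)
    have "v = ereal (real_of_ereal (A (i # J)) + sum_at x J)"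
      unfolding J(2) by (subst tensor_entry_real[OF assms(1,2) T]) simp
    then show ?thesis using shapley_le[OF T, of x] by simp
  qed (simp add: J)
qed simp

lemma tropical_H_eigenpair_iff_shapley:
  assumes "m \<ge> 1" "is_tensor m A" "\<And>i. finite_tails m A i \<noteq> {}"
  shows "tropical_H_eigenpair m A x l \<longleftrightarrow>
           (\<forall>i. shapley m A x i = l + (real m - 1) * x $ i)"
  unfolding tropical_H_eigenpair_def
  by (simp add: Min_tensor_eq_shapley[OF assms] del: One_nat_def)

text \<open>Grouping the constraints by their first index turns the linear program into
  sub-eigenvector inequalities, directly comparable with the eigenvector equations.\<close>

lemma primal_feasible_iff_shapley:
  assumes "m \<ge> 1" "is_tensor m A" "\<And>i. finite_tails m A i \<noteq> {}"
  shows "primal_feasible m A (l, x) \<longleftrightarrow>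
           (\<forall>i. l + (real m - 1) * x $ i \<le> shapley m A x i)"
proof -
  have "primal_feasible m A (l, x) \<longleftrightarrow>
      (\<forall>i. \<forall>J \<in> multi_indices (m - 1).
         ereal (l + (real m - 1) * x $ i) \<le> A (i # J) + ereal (sum_at x J))"
    using assms(1) unfolding primal_feasible_def prod.case
    by (metis Cons_in_multi_indices multi_indices_Cons_cases list.sel(1,3))
  also have "\<dots> \<longleftrightarrow> (\<forall>i. ereal (l + (real m - 1) * x $ i) \<le>
      (MIN J \<in> multi_indices (m - 1). A (i # J) + ereal (sum_at x J)))"
    using assms(3) by (subst Min_ge_iff) (auto simp: finite_tails_def)
  finally show ?thesis by (simp add: Min_tensor_eq_shapley[OF assms] del: One_nat_def)
qed

subsection \<open>Existence of an eigenpair\<close>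

text \<open>Take a minimiser \<open>K\<close> at \<open>j\<close>. Since the support families agree,
  some \<open>J\<close> with a finite entry at \<open>i\<close> has the same underlying set, and it
  competes in the minimum at \<open>i\<close>. The two tensor entries account for the constant, and
  the summand shared by \<open>J\<close> and \<open>K\<close> reduces the factor of \<open>R\<close>
  from m - 1 to m - 2.\<close>

lemma shapley_oscillation:
  assumes "m \<ge> 2" "\<And>i. support_sets m A i \<noteq> {}"
    and "\<And>i j. support_sets m A i = support_sets m A j"
    and "\<And>i j. x $ i - x $ j \<le> R"
  shows "shapley m A x i - shapley m A x j
           \<le> 2 * (\<Sum>I \<in> multi_indices m. \<bar>real_of_ereal (A I)\<bar>) + (real m - 2) * R"
proof -
  have "finite_tails m A j \<noteq> {}" using assms(2)[of j] by (simp add: support_sets_eq_image)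
  then obtain K where K: "K \<in> finite_tails m A j"
      "shapley m A x j = real_of_ereal (A (j # K)) + sum_at x K"
    by (rule shapley_attained)
  have "set K \<in> support_sets m A i"
    using K(1) assms(3)[of i j] by (simp add: support_sets_eq_image)
  then obtain J where J: "J \<in> finite_tails m A i" "set J = set K"
    by (auto simp: support_sets_eq_image)
  have len: "length J = m - 1" "length K = m - 1"
    using J K by (auto simp: finite_tails_def multi_indices_def)
  have "sum_at x J - sum_at x K \<le> (real (length J) - 1) * R"
    using len assms(1) J(2) assms(4) by (intro sum_at_diff_le_same_set) auto
  then have osc: "sum_at x J - sum_at x K \<le> (real m - 2) * R"
    using len assms(1) by (simp add: of_nat_diff)
  \<comment> \<open>A crude uniform bound suffices; infinite entries contribute 0 to the sum, as
    \<open>real_of_ereal\<close> sends them to 0.\<close>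
  have entry: "\<bar>real_of_ereal (A I)\<bar> \<le> (\<Sum>I \<in> multi_indices m. \<bar>real_of_ereal (A I)\<bar>)"
    if "I \<in> multi_indices m" for I
    using that by (intro member_le_sum abs_ge_zero) auto
  have "i # J \<in> multi_indices m" "j # K \<in> multi_indices m"
    using len assms(1) by (auto simp: multi_indices_def)
  then show ?thesis
    using entry[of "i # J"] entry[of "j # K"] shapley_le[OF J(1), of x] K(2) osc by linarith
qed

lemma ex_shapley_eigenpair:
  assumes "m \<ge> 2" "\<And>i. support_sets m A i \<noteq> {}"
    and "\<And>i j. support_sets m A i = support_sets m A j"
  shows "\<exists>x l. \<forall>i. shapley m A x i = l + (real m - 1) * x $ (i :: 'n::finite)"
proof -
  \<comment> \<open>For this \<open>R\<close> the oscillation bound becomes R + (m - 2) R = (m - 1)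
    R, which division by m - 1 brings back to \<open>R\<close>.\<close>
  define R where "R = 2 * (\<Sum>I \<in> multi_indices m. \<bar>real_of_ereal (A I)\<bar>)"
  have "R \<ge> 0" unfolding R_def by (intro mult_nonneg_nonneg sum_nonneg abs_ge_zero) simp
  \<comment> \<open>An arbitrary reference coordinate. Pinning it to 0 selects one representative
    modulo constant vectors, which makes \<open>D\<close> bounded.\<close>
  define k :: 'n where "k = undefined"
  define D where "D = {x :: real ^ 'n. x $ k = 0} \<inter> {x. \<forall>i j. x $ i - x $ j \<le> R}"
  define G where "G x = (\<chi> i. (shapley m A x i - shapley m A x k) / (real m - 1))" for x
  have tails: "finite_tails m A i \<noteq> {}" for i
    using assms(2)[of i] by (simp add: support_sets_eq_image)
  have "closed D"
    unfolding D_def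
    by (intro closed_Int closed_Collect_all closed_Collect_eq closed_Collect_le continuous_intros)
  moreover have "D \<subseteq> cbox (vec (- R)) (vec R)"
  proof
    fix x assume x: "x \<in> D"
    have "- R \<le> x $ i \<and> x $ i \<le> R" for i
    proof -
      have "x $ k = 0" "\<forall>i j. x $ i - x $ j \<le> R" using x by (simp_all add: D_def)
      from this(1) this(2)[rule_format, of i k] this(2)[rule_format, of k i]
      show ?thesis by linarith
    qed
    then show "x \<in> cbox (vec (- R)) (vec R)" by (simp add: mem_box_cart)
  qed
  ultimately have "compact D"
    by (meson bounded_cbox bounded_subset compact_eq_bounded_closed)
  moreover have "convex D"
  proof (rule convexI)
    fix x y :: "real ^ 'n" and u v :: real
    assume x: "x \<in> D" and y: "y \<in> D" and uv: "0 \<le> u" "0 \<le> v" "u + v = 1"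
    have "u * x $ i + v * y $ i - (u * x $ j + v * y $ j) \<le> R" for i j
    proof -
      have "u * (x $ i - x $ j) + v * (y $ i - y $ j) \<le> R"
        using x y uv by (intro convex_bound_le) (auto simp: D_def)
      then show ?thesis by (simp add: algebra_simps)
    qed
    then show "u *\<^sub>R x + v *\<^sub>R y \<in> D" using x y by (auto simp: D_def)
  qed
  moreover have "D \<noteq> {}"
  proof -
    have "0 \<in> D" using \<open>R \<ge> 0\<close> by (simp add: D_def)
    then show ?thesis by blast
  qed
  moreover have "continuous_on D G"
    unfolding G_def using tails assms(1)
    by (intro continuous_on_vec_lambda continuous_intros continuous_on_shapley) auto
  moreover have "G \<in> D \<rightarrow> D"
  proof
    fix x assume "x \<in> D"
    then have "shapley m A x i - shapley m A x j \<le> R + (real m - 2) * R" for i j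
      unfolding R_def by (intro shapley_oscillation assms) (auto simp: D_def R_def)
    then have "(shapley m A x i - shapley m A x j) / (real m - 1) \<le> R" for i j
      using assms(1) by (simp add: divide_simps algebra_simps)
    then show "G x \<in> D" by (simp add: D_def G_def flip: diff_divide_distrib)
  qed
  ultimately obtain x where "G x = x" using brouwer[of D G] by blast
  then have "x $ i = (shapley m A x i - shapley m A x k) / (real m - 1)" for i
    by (metis G_def vec_lambda_beta)
  \<comment> \<open>The value subtracted by the normalisation at the fixed point becomes the
    eigenvalue.\<close>
  then have "shapley m A x i = shapley m A x k + (real m - 1) * x $ i" for i
    using assms(1) by (simp add: field_simps)
  then show ?thesis by blast
qed

subsection \<open>Primal optimality\<close>

text \<open>Let c be the maximum of y - x, attained at \<open>i\<close>, and let \<open>J\<close> be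
  a minimiser at \<open>x\<close> for \<open>i\<close>. Passing from \<open>x\<close> to
  \<open>y\<close> raises the sum over \<open>J\<close> by at most (m - 1) c, and raises (m - 1)
  times the \<open>i\<close>-th coordinate by exactly (m - 1) c, so these terms cancel. The
  comparison serves both primal optimality and uniqueness of the eigenvalue.\<close>

lemma shapley_subeigenvalue_le:
  assumes "m \<ge> 1" "\<And>i. finite_tails m A i \<noteq> {}"
    and "\<And>i. shapley m A x i \<le> l + (real m - 1) * x $ i"
    and "\<And>i. l' + (real m - 1) * y $ i \<le> shapley m A y i"
  shows "l' \<le> l"
proof -
  define c where "c = (MAX i. y $ i - x $ i)"
  have "c \<in> range (\<lambda>i. y $ i - x $ i)" unfolding c_def by (intro Max_in) auto
  then obtain i where i: "c = y $ i - x $ i" by auto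
  have "y $ j - x $ j \<le> c" for j unfolding c_def by (intro Max_ge) auto
  then have le: "y $ j \<le> x $ j + c" for j by (simp add: algebra_simps)
  obtain J where J: "J \<in> finite_tails m A i"
      "shapley m A x i = real_of_ereal (A (i # J)) + sum_at x J"
    using shapley_attained[OF assms(2)] by metis
  have "real (length J) = real m - 1"
    using J(1) assms(1) by (auto simp: finite_tails_def multi_indices_def of_nat_diff)
  then have "sum_at y J \<le> sum_at x J + (real m - 1) * c"
    using sum_at_le_add_const[OF le, of J] by simp
  then have "l' + (real m - 1) * y $ i \<le> l + (real m - 1) * x $ i + (real m - 1) * c"
    using assms(3)[of i] assms(4)[of i] shapley_le[OF J(1), of y] J(2) by linarith
  then show ?thesis by (simp add: i algebra_simps)
qed

subsection \<open>Dual optimality\<close>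

text \<open>Pairing the balance equation with \<open>x\<close> removes every term in
  \<open>x\<close>, and total weight 1 leaves \<open>l\<close>. Both the weak inequality and its
  attainment rest on this identity.\<close>

lemma dual_feasible_weight:
  fixes x :: "real ^ 'n::finite"
  assumes "dual_feasible m y"
  shows "(\<Sum>I \<in> multi_indices m.
            (l + (real m - 1) * x $ hd I - sum_at x (tl I)) * y I) = l"
proof -
  have "0 = x \<bullet> (\<Sum>I \<in> multi_indices m.
      y I *\<^sub>R ((real m - 1) *\<^sub>R axis (hd I) 1 - (\<Sum>j\<leftarrow>tl I. axis j 1)))"
    using assms by (simp add: dual_feasible_def)
  also have "\<dots> = (\<Sum>I \<in> multi_indices m. y I * ((real m - 1) * x $ hd I - sum_at x (tl I)))"
    by (simp add: inner_sum_right inner_diff_right inner_sum_list_axis inner_axis)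
  finally have "(\<Sum>I \<in> multi_indices m. y I * ((real m - 1) * x $ hd I - sum_at x (tl I))) = 0"
    by simp
  moreover have "(\<Sum>I \<in> multi_indices m. l * y I) = l"
    using assms by (simp add: dual_feasible_def flip: sum_distrib_left)
  ultimately show ?thesis
    by (simp add: algebra_simps sum.distrib sum_subtractf)
qed

lemma weak_duality:
  assumes "primal_feasible m A (l, x)" "dual_feasible m y"
  shows "ereal l \<le> dual_objective m A y"
proof -
  have "ereal l = (\<Sum>I \<in> multi_indices m.
      ereal ((l + (real m - 1) * x $ hd I - sum_at x (tl I)) * y I))"
    by (simp add: dual_feasible_weight[OF assms(2)])
  also have "\<dots> \<le> (\<Sum>I \<in> multi_indices m. A I * ereal (y I))"
  proof (rule sum_mono)
    fix I :: "'a list" assume I: "I \<in> multi_indices m"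
    have "ereal (l + (real m - 1) * x $ hd I) \<le> A I + ereal (sum_at x (tl I))"
      using assms(1) I by (simp add: primal_feasible_def)
    \<comment> \<open>The primal constraint bounds each entry below by a real number, whether or not
      the entry is infinite; the nonnegative dual weights preserve this bound.\<close>
    then have "ereal (l + (real m - 1) * x $ hd I - sum_at x (tl I)) \<le> A I"
      by (cases "A I") auto
    moreover have "0 \<le> ereal (y I)" using assms(2) I by (simp add: dual_feasible_def)
    ultimately show "ereal ((l + (real m - 1) * x $ hd I - sum_at x (tl I)) * y I)
        \<le> A I * ereal (y I)"
      by (metis ereal_mult_right_mono times_ereal.simps(1))
  qed
  finally show ?thesis by (simp add: dual_objective_def)
qed

text \<open>Brouwer's theorem on the probability simplex: multiplication by a matrix whose rows are
  probability vectors preserves total mass and nonnegativity.\<close>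

lemma ex_stationary_distribution:
  fixes P :: "'n::finite \<Rightarrow> 'n \<Rightarrow> real"
  assumes "\<And>i j. 0 \<le> P i j" "\<And>i. (\<Sum>j\<in>UNIV. P i j) = 1"
  obtains p :: "'n \<Rightarrow> real"
    where "\<And>i. 0 \<le> p i" "(\<Sum>i\<in>UNIV. p i) = 1" "\<And>j. (\<Sum>i\<in>UNIV. p i * P i j) = p j"
proof -
  define D where "D = {x :: real ^ 'n. \<forall>i. 0 \<le> x $ i} \<inter> {x. (\<Sum>i\<in>UNIV. x $ i) = 1}"
  define G where "G x = (\<chi> j. \<Sum>i\<in>UNIV. x $ i * P i j)" for x :: "real ^ 'n"
  have "closed D"
    unfolding D_def
    by (intro closed_Int closed_Collect_all closed_Collect_eq closed_Collect_le continuous_intros)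
  moreover have "D \<subseteq> cbox (vec 0) (vec 1)"
  proof
    fix x assume x: "x \<in> D"
    have "x $ i \<le> (\<Sum>i\<in>UNIV. x $ i)" for i
      using x by (intro member_le_sum) (auto simp: D_def)
    then show "x \<in> cbox (vec 0) (vec 1)" using x by (auto simp: mem_box_cart D_def)
  qed
  ultimately have "compact D"
    by (meson bounded_cbox bounded_subset compact_eq_bounded_closed)
  moreover have "convex D"
    by (rule convexI) (auto simp: D_def sum.distrib simp flip: sum_distrib_left)
  moreover have "D \<noteq> {}"
  proof -
    have "axis undefined 1 \<in> D" by (simp add: D_def axis_def)
    then show ?thesis by blast
  qed
  moreover have "continuous_on D G"
    unfolding G_def by (intro continuous_on_vec_lambda continuous_intros)
  moreover have "G \<in> D \<rightarrow> D"
  proof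
    fix x assume x: "x \<in> D"
    have "(\<Sum>j\<in>UNIV. \<Sum>i\<in>UNIV. x $ i * P i j) = (\<Sum>i\<in>UNIV. \<Sum>j\<in>UNIV. x $ i * P i j)"
      by (rule sum.swap)
    also have "\<dots> = 1" using x by (simp add: D_def assms(2) flip: sum_distrib_left)
    finally show "G x \<in> D" using x assms(1) by (simp add: D_def G_def sum_nonneg)
  qed
  ultimately obtain x where x: "x \<in> D" "G x = x"
    using brouwer[of D G] by blast
  show thesis
  proof
    show "0 \<le> x $ i" for i using x(1) by (simp add: D_def)
    show "(\<Sum>i\<in>UNIV. x $ i) = 1" using x(1) by (simp add: D_def)
    show "(\<Sum>i\<in>UNIV. x $ i * P i j) = x $ j" for j
      using x(2) by (metis G_def vec_lambda_beta)
  qed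
qed

lemma sum_multi_indices_selection:
  fixes J :: "'n::finite \<Rightarrow> 'n list" and f :: "'n list \<Rightarrow> 'b::comm_monoid_add"
  assumes "m \<ge> 1" "\<And>i. J i \<in> multi_indices (m - 1)"
    and "\<And>I. I \<in> multi_indices m \<Longrightarrow> tl I \<noteq> J (hd I) \<Longrightarrow> f I = 0"
  shows "(\<Sum>I \<in> multi_indices m. f I) = (\<Sum>i\<in>UNIV. f (i # J i))"
proof -
  have "(\<Sum>I \<in> multi_indices m. f I) = (\<Sum>I \<in> range (\<lambda>i. i # J i). f I)"
  proof (rule sum.mono_neutral_right)
    show "range (\<lambda>i. i # J i) \<subseteq> multi_indices m"
      using assms(1,2) by (auto simp: Cons_in_multi_indices)
    show "\<forall>I \<in> multi_indices m - range (\<lambda>i. i # J i). f I = 0"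
    proof
      fix I assume I: "I \<in> multi_indices m - range (\<lambda>i. i # J i)"
      then obtain i K where "I = i # K" using assms(1) by (meson DiffD1 multi_indices_Cons_cases)
      then show "f I = 0" using I by (intro assms(3)) auto
    qed
  qed simp
  also have "\<dots> = (\<Sum>i\<in>UNIV. f (i # J i))"
    by (subst sum.reindex) (auto simp: inj_on_def)
  finally show ?thesis .
qed

text \<open>If (i, J i) carries weight p i, coordinate j of the balance equation says that (m - 1) p
  j is the sum over i of p i times the multiplicity of j in J i. Divided by m - 1, this is
  stationarity of \<open>p\<close>.\<close>

lemma ex_dual_feasible_on_selection:
  fixes J :: "'n::finite \<Rightarrow> 'n list"
  assumes "m \<ge> 2" "\<And>i. J i \<in> multi_indices (m - 1)"
  obtains y where "dual_feasible m y" "\<And>I. tl I \<noteq> J (hd I) \<Longrightarrow> y I = 0"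
proof -
  have len: "real (length (J i)) = real m - 1" for i
    using assms(1) assms(2)[of i] by (simp add: multi_indices_def of_nat_diff)
  obtain p :: "'n \<Rightarrow> real" where p: "\<And>i. 0 \<le> p i" "(\<Sum>i\<in>UNIV. p i) = 1"
      "\<And>j. (\<Sum>i\<in>UNIV. p i * (real (count_list (J i) j) / (real m - 1))) = p j"
  \<comment> \<open>Transition probabilities count multiplicities: an entry repeated in
    \<open>J i\<close> is proportionally more likely. The rows sum to 1 because \<open>J i\<close>
    has m - 1 > 0 entries.\<close>
  proof (rule ex_stationary_distribution[of "\<lambda>i j. real (count_list (J i) j) / (real m - 1)"])
    show "0 \<le> real (count_list (J i) j) / (real m - 1)" for i j
      using assms(1) by simp
    show "(\<Sum>j\<in>UNIV. real (count_list (J i) j) / (real m - 1)) = 1" for i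
      using assms(1) by (simp add: sum_count_list len flip: sum_divide_distrib)
  qed blast
  define y where "y I = (if tl I = J (hd I) then p (hd I) else 0)" for I
  have sum_p: "(\<Sum>i\<in>UNIV. p i * real (count_list (J i) j)) = (real m - 1) * p j" for j
  proof -
    have "(\<Sum>i\<in>UNIV. p i * real (count_list (J i) j)) / (real m - 1) = p j"
      using p(3)[of j] by (simp add: sum_divide_distrib)
    then show ?thesis using assms(1) by (simp add: field_simps)
  qed
  have "(\<Sum>I \<in> multi_indices m.
      y I *\<^sub>R ((real m - 1) *\<^sub>R axis (hd I) 1 - (\<Sum>j\<leftarrow>tl I. axis j 1)))
      = (\<Sum>i\<in>UNIV. p i *\<^sub>R ((real m - 1) *\<^sub>R axis i 1 - (\<Sum>j\<leftarrow>J i. axis j 1)) :: real ^ 'n)"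
    using assms by (subst sum_multi_indices_selection[where J = J]) (auto simp: y_def)
  also have "\<dots> = 0"
  proof (rule vec_eq_iff[THEN iffD2], rule allI)
    fix j
    have "(\<Sum>i\<in>UNIV. p i * ((real m - 1) * axis i 1 $ j)) = (real m - 1) * p j"
      by (simp add: axis_def if_distrib sum.delta cong: if_cong)
    then show "(\<Sum>i\<in>UNIV. p i *\<^sub>R ((real m - 1) *\<^sub>R axis i 1 - (\<Sum>j\<leftarrow>J i. axis j 1))) $ j
        = (0 :: real ^ 'n) $ j"
      by (simp add: sum_list_axis_nth right_diff_distrib sum_subtractf sum_p)
  qed
  finally have "(\<Sum>I \<in> multi_indices m.
      y I *\<^sub>R ((real m - 1) *\<^sub>R axis (hd I) 1 - (\<Sum>j\<leftarrow>tl I. axis j 1))) = (0 :: real ^ 'n)" .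
  moreover have "(\<Sum>I \<in> multi_indices m. y I) = 1"
    using assms p(2) by (subst sum_multi_indices_selection[where J = J]) (auto simp: y_def)
  ultimately have "dual_feasible m y"
    using p(1) by (auto simp: dual_feasible_def y_def)
  then show thesis using that[of y] by (simp add: y_def)
qed

text \<open>Complementary slackness: \<open>y\<close> lives on constraints that are tight at the
  eigenvector, so the term-by-term estimate of weak duality becomes an equality.\<close>

lemma ex_dual_feasible_attaining:
  assumes "m \<ge> 2" "is_tensor m A" "\<And>i. finite_tails m A i \<noteq> {}"
    and "\<And>i. shapley m A x i = l + (real m - 1) * x $ i"
  obtains y where "dual_feasible m y" "dual_objective m A y = ereal l"
proof -
  have m: "m \<ge> 1" using assms(1) by simp
  have "\<exists>J \<in> finite_tails m A i. shapley m A x i = real_of_ereal (A (i # J)) + sum_at x J" for i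
    using shapley_attained[OF assms(3)] by metis
  then obtain J where J: "\<And>i. J i \<in> finite_tails m A i"
      "\<And>i. shapley m A x i = real_of_ereal (A (i # J i)) + sum_at x (J i)"
    by metis
  obtain y where y: "dual_feasible m y" "\<And>I. tl I \<noteq> J (hd I) \<Longrightarrow> y I = 0"
    using ex_dual_feasible_on_selection[OF assms(1), of J] J(1) by (auto simp: finite_tails_def)
  have entry: "A (i # J i) = ereal (l + (real m - 1) * x $ i - sum_at x (J i))" for i
  proof -
    have "real_of_ereal (A (i # J i)) = l + (real m - 1) * x $ i - sum_at x (J i)"
      using assms(4)[of i] J(2)[of i] by linarith
    then show ?thesis using tensor_entry_real[OF m assms(2) J(1), of i] by simp
  qed
  \<comment> \<open>Off the selected multi-indices both sides vanish, even where the entry is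
    infinite, by the convention that infinity times 0 is 0.\<close>
  have "A I * ereal (y I) = ereal ((l + (real m - 1) * x $ hd I - sum_at x (tl I)) * y I)"
    if "I \<in> multi_indices m" for I
  proof (cases "tl I = J (hd I)")
    case True
    then have "I = hd I # J (hd I)"
      using that m by (metis multi_indices_Cons_cases list.collapse list.distinct(1))
    then show ?thesis using entry[of "hd I"] True by simp
  qed (simp add: y(2) flip: zero_ereal_def)
  then have "dual_objective m A y
      = (\<Sum>I \<in> multi_indices m. ereal ((l + (real m - 1) * x $ hd I - sum_at x (tl I)) * y I))"
    unfolding dual_objective_def by (intro sum.cong) auto
  also have "\<dots> = ereal l" by (simp add: dual_feasible_weight[OF y(1)])
  finally show thesis using that y(1) by blast
qed

theorem theorem3:
  fixes m :: nat and A :: "'n::finite list \<Rightarrow> ereal"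
  assumes "m \<ge> 2"
    and "is_tensor m A"
    and "symmetric_in_last m A"
    and "\<And>i. support_sets m A i \<noteq> {}"
    and "\<And>i j. support_sets m A i = support_sets m A j"
  shows "(\<exists>!l. \<exists>x. tropical_H_eigenpair m A x l) \<and>
         primal_optimal_value m A (tropical_H_eigenvalue m A) \<and>
         dual_optimal_value m A (ereal (tropical_H_eigenvalue m A))"
proof -
  have m: "m \<ge> 1" using assms(1) by simp
  have tails: "finite_tails m A i \<noteq> {}" for i
    using assms(4)[of i] by (simp add: support_sets_eq_image)
  note eigen = tropical_H_eigenpair_iff_shapley[OF m assms(2) tails]
  note feasible = primal_feasible_iff_shapley[OF m assms(2) tails]
  obtain x l where xl: "\<And>i. shapley m A x i = l + (real m - 1) * x $ i"
    using ex_shapley_eigenpair[OF assms(1,4,5)] by blast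
  have le: "l' \<le> l" if "primal_feasible m A (l', z)" for l' z
    using that xl shapley_subeigenvalue_le[OF m tails, of x l l' z] by (simp add: feasible)
  \<comment> \<open>An eigenpair is primal feasible, which gives one inequality; exchanging the
    roles of the two eigenvectors in the comparison gives the other.\<close>
  have unique: "l' = l" if "tropical_H_eigenpair m A z l'" for l' z
  proof (rule antisym)
    show "l' \<le> l" using that by (intro le[of l' z]) (simp add: eigen feasible)
    show "l \<le> l'"
      using that xl shapley_subeigenvalue_le[OF m tails, of z l' l x] by (simp add: eigen)
  qed
  have ex: "tropical_H_eigenpair m A x l" using xl by (simp add: eigen)
  have ex1: "\<exists>!l. \<exists>x. tropical_H_eigenpair m A x l" using ex unique by blast
  have val: "tropical_H_eigenvalue m A = l"
    unfolding tropical_H_eigenvalue_def using ex unique by blast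
  have prim: "primal_feasible m A (l, x)" using xl by (simp add: feasible)
  then have "is_arg_max fst (primal_feasible m A) (l, x)"
    using le by (auto simp: is_arg_max_def not_less)
  then have "primal_optimal_value m A l"
    unfolding primal_optimal_value_def by (intro exI[of _ "(l, x)"]) simp
  moreover obtain y where y: "dual_feasible m y" "dual_objective m A y = ereal l"
    using ex_dual_feasible_attaining[OF assms(1,2) tails xl] by blast
  then have "dual_optimal_value m A (ereal l)"
    unfolding dual_optimal_value_def is_arg_min_def using weak_duality[OF prim]
    by (metis not_less)
  ultimately show ?thesis using ex1 val by simp
qed

end
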